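(* Let $D,E,G,H,J$ be complex numbers and put $A=-D+E+G+H-3$, $B=12D+12G-4J-12$, $C=-E-2G-H+4$, $F=-2D-2G-2H+6$, $I=4D-E+2G-H-J$, and assume $I\ne0$. Then for every integer $n\ge0$, $$\begin{aligned} I\,t_n^{1}&=\sum_{\substack{k_1+k_2+k_3+k_4=n\\ k_1,k_2,k_3,k_4\ge 0}}\binom{n}{k_1,k_2,k_3,k_4}T_{k_1}T_{k_2}T_{k_3}T_{k_4}\\ &\quad-\frac{A}{563^2}4^nT_n^{(3052,4658,8804,16451)}+\frac{B}{563}-\frac{C}{563}\sum_{k=0}^n\binom nk3^{n-k}T_{n-k}^{(15,27,48,107)}T_k\\ &\quad-\frac{D}{563^2}\sum_{k=0}^n\binom nk2^nT_{n-k}^{(40,64,215,344)}T_k^{(40,64,215,344)}\\ &\quad-\frac{E}{563}\sum_{k=0}^n\binom nk2^{n-k}T_{n-k}^{(40,64,215,344)}t_k-F\sum_{k=0}^n\binom nkt_{n-k}t_k\\ &\quad-\frac{G}{563}\sum_{\substack{k_1+k_2+k_3=n\\ k_1,k_2,k_3\ge 0}}\binom{n}{k_1,k_2,k_3}2^{k_1}T_{k_1}^{(40,64,215,344)}T_{k_2}T_{k_3}\\ &\quad-H\sum_{\substack{k_1+k_2+k_3=n\\ k_1,k_2,k_3\ge 0}}\binom{n}{k_1,k_2,k_3}t_{k_1}T_{k_2}T_{k_3}\\ &\quad+\frac{J}{563}\sum_{\substack{k_1+k_2+k_3=n\\ k_1,k_2,k_3\ge 0}}\binom{n}{k_1,k_2,k_3}(-1)^{k_1}T_{k_1}^{(-5,2,13,32)}T_{k_2},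 \end{aligned}$$ where $$t_n=\frac12\left(\sum_{k=0}^n\binom nkT_kT_{n-k}-\frac{2^n}{563}T_n^{(40,64,215,344)}\right).$$
   Context: For given $s_0,s_1,s_2,s_3$, the sequence $T_n^{(s_0,s_1,s_2,s_3)}$ is defined by $T_j^{(s_0,s_1,s_2,s_3)}=s_j$ for $0\le j\le 3$ and, for $n\ge4$, each term being the sum of the four preceding terms. The Tetranacci numbers are $T_n=T_n^{(0,1,1,2)}$. The multinomial coefficient is $\binom{n}{k_1,\dots,k_r}=\frac{n!}{k_1!\cdots k_r!}$. Let $\alpha,\beta,\gamma,\delta$ be the (distinct, complex) roots of $x^4-x^3-x^2-x-1=0$ and $c_1=\frac1{-\alpha^3+6\alpha-1}$, $c_2=\frac1{-\beta^3+6\beta-1}$, $c_3=\frac1{-\gamma^3+6\gamma-1}$, $c_4=\frac1{-\delta^3+6\delta-1}$ (so $\sum_{n\ge0}T_n\frac{x^n}{n!}=c_1e^{\alpha x}+c_2e^{\beta x}+c_3e^{\gamma x}+c_4e^{\delta x}$). The numbers $t_n^1$ (the superscript is an index, not a power) are defined by $$\begin{aligned}\sum_{n=0}^\infty t_n^{1}\frac{x^n}{n!}&=c_1c_2c_3e^{(\alpha+\beta+\gamma)x}(c_1e^{\alpha x}+c_2e^{\beta x}+c_3e^{\gamma x})+c_2c_3c_4e^{(\beta+\gamma+\delta)x}(c_2e^{\beta x}+c_3e^{\gamma x}+c_4e^{\delta x})\\&\quad+c_1c_2c_4e^{(\alpha+\beta+\delta)x}(c_1e^{\alpha x}+c_2e^{\beta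 x}+c_4e^{\delta x})+c_1c_3c_4e^{(\alpha+\gamma+\delta)x}(c_1e^{\alpha x}+c_3e^{\gamma x}+c_4e^{\delta x}).\end{aligned}$$ *)

theory Defs
  imports Complex_Main "HOL-Computational_Algebra.Formal_Power_Series"
begin

fun tetra :: "'a::comm_monoid_add \<Rightarrow> 'a \<Rightarrow> 'a \<Rightarrow> 'a \<Rightarrow> nat \<Rightarrow> 'a" where
  "tetra s0 s1 s2 s3 0 = s0"
| "tetra s0 s1 s2 s3 (Suc 0) = s1"
| "tetra s0 s1 s2 s3 (Suc (Suc 0)) = s2"
| "tetra s0 s1 s2 s3 (Suc (Suc (Suc 0))) = s3"
| "tetra s0 s1 s2 s3 (Suc (Suc (Suc (Suc n)))) =
     tetra s0 s1 s2 s3 (Suc (Suc (Suc n))) + tetra s0 s1 s2 s3 (Suc (Suc n))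
     + tetra s0 s1 s2 s3 (Suc n) + tetra s0 s1 s2 s3 n"

definition tetranacci :: "nat \<Rightarrow> complex" where
  "tetranacci = tetra 0 1 1 2"

definition multinomial :: "nat \<Rightarrow> nat list \<Rightarrow> complex" where
  "multinomial n ks = fact n / (\<Prod>k\<leftarrow>ks. fact k)"

definition tetra_t :: "nat \<Rightarrow> complex" where
  "tetra_t n =
     1 / 2 * ((\<Sum>k=0..n. of_nat (n choose k) * tetranacci k * tetranacci (n - k))
              - 2 ^ n / 563 * tetra 40 64 215 344 n)"

definition binet_coeff :: "complex \<Rightarrow> complex" where
  "binet_coeff x = 1 / (- (x ^ 3) + 6 * x - 1)"

text \<open>Exponential generating functions are formal power series; \<^term>\<open>fps_exp a\<close> is the
  series of \<open>e\<^sup>a\<^sup>x\<close>.\<close>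

definition egf :: "(nat \<Rightarrow> complex) \<Rightarrow> complex fps" where
  "egf f = Abs_fps (\<lambda>n. f n / fact n)"

definition t1_series :: "complex \<Rightarrow> complex \<Rightarrow> complex \<Rightarrow> complex \<Rightarrow> complex fps" where
  "t1_series \<alpha> \<beta> \<gamma> \<delta> =
     (let c1 = fps_const (binet_coeff \<alpha>); c2 = fps_const (binet_coeff \<beta>);
          c3 = fps_const (binet_coeff \<gamma>); c4 = fps_const (binet_coeff \<delta>)
      in c1 * c2 * c3 * fps_exp (\<alpha> + \<beta> + \<gamma>)
           * (c1 * fps_exp \<alpha> + c2 * fps_exp \<beta> + c3 * fps_exp \<gamma>)
       + c2 * c3 * c4 * fps_exp (\<beta> + \<gamma> + \<delta>)
           * (c2 * fps_exp \<beta> + c3 * fps_exp \<gamma> + c4 * fps_exp \<delta>)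
       + c1 * c2 * c4 * fps_exp (\<alpha> + \<beta> + \<delta>)
           * (c1 * fps_exp \<alpha> + c2 * fps_exp \<beta> + c4 * fps_exp \<delta>)
       + c1 * c3 * c4 * fps_exp (\<alpha> + \<gamma> + \<delta>)
           * (c1 * fps_exp \<alpha> + c3 * fps_exp \<gamma> + c4 * fps_exp \<delta>))"

definition t1 :: "complex \<Rightarrow> complex \<Rightarrow> complex \<Rightarrow> complex \<Rightarrow> nat \<Rightarrow> complex" where
  "t1 \<alpha> \<beta> \<gamma> \<delta> n = fact n * fps_nth (t1_series \<alpha> \<beta> \<gamma> \<delta>) n"

lemma egf_t1: "egf (t1 \<alpha> \<beta> \<gamma> \<delta>) = t1_series \<alpha> \<beta> \<gamma> \<delta>"
  by (rule fps_ext) (simp add: egf_def t1_def)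

lemma egf_eq_t1_series_iff: "egf f = t1_series \<alpha> \<beta> \<gamma> \<delta> \<longleftrightarrow> f = t1 \<alpha> \<beta> \<gamma> \<delta>"
  by (auto simp: fps_eq_iff fun_eq_iff egf_def t1_def field_simps)

end

theory Submission
  imports Defs
begin

text \<open>
  Write \<open>a, b, c, d\<close> for the four series \<open>c\<^sub>i e\<^bsup>\<alpha>\<^sub>i x\<^esup>\<close>, one for each root
  \<open>\<alpha>\<^sub>i\<close>, and let \<open>p\<^sub>k\<close> and \<open>e\<^sub>k\<close> be their power sums and elementary symmetric functions. Each
  sequence in the theorem is, up to a scalar, generated by a symmetric polynomial in these series.
  The numbers \<open>T\<^sub>n\<close> have the series \<open>p\<^sub>1\<close>. The generating function of the sequence
  \<open>k\<^sup>n \<Sum>\<^sub>i c\<^sub>i\<^sup>k \<alpha>\<^sub>i\<^sup>n\<close> is \<open>p\<^sub>k\<close>, and for \<open>k = 2, 3, 4\<close> the inner sum is a rational multiple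
  of a sequence with the Tetranacci recurrence (\<open>binet2\<close>, \<open>binet3\<close>, \<open>binet4\<close>). As
  \<open>2 e\<^sub>2 = p\<^sub>1\<^sup>2 - p\<^sub>2\<close>, the numbers \<open>t\<^sub>n\<close> have the series \<open>e\<^sub>2\<close>. The roots have sum 1 and the \<open>c\<^sub>i\<close>
  have product \<open>-1/563\<close>, so \<open>e\<^sub>4 = - e\<^sup>x / 563\<close>; this accounts for the constant term \<open>B / 563\<close>. A
  product of three of the four series equals \<open>e\<^sub>4\<close> divided by the remaining one. The division turns
  \<open>e\<^bsup>\<alpha>\<^sub>i x\<^esup>\<close> into \<open>e\<^bsup>- \<alpha>\<^sub>i x\<^esup>\<close>, hence the factor \<open>(- 1)\<^sup>k\<close>, and \<open>e\<^sup>x\<close> is the series of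
  the constant sequence 1, hence only two Tetranacci factors in the triple sum that represents
  \<open>e\<^sub>3 p\<^sub>1\<close>
  (\<open>egf_e3\<close>). The numbers \<open>t\<^sub>n\<^sup>1\<close> belong to \<open>m = \<Sum> a\<^sup>2bc\<close>, the monomial symmetric function of
  shape \<open>(2,1,1)\<close>.

  Convolution of sequences is multiplication of series, so the theorem is a linear relation between
  symmetric polynomials of degree four. That space has dimension five, with basis
  \<open>p\<^sub>4, p\<^sub>3p\<^sub>1, p\<^sub>2\<^sup>2, m, e\<^sub>4\<close>, and the other six products that occur are expanded in this basis by
  \<open>symmetric_products\<close>. The six expansions allow a family of representations of \<open>m\<close> with the free
  parameters \<open>D, E, G, H, J\<close>; comparing coefficients gives \<open>A, B, C, F\<close> and the factor \<open>I\<close>.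
\<close>

section \<open>Coefficients of products of exponential generating functions\<close>

lemma fps_nth_egf [simp]: "fps_nth (egf f) n = f n / fact n"
  by (simp add: egf_def)

text \<open>Stated with the factorial on the side of the series, because the formulas for coefficients
  below are all of this shape.\<close>

lemma egf_eqI: "(\<And>n. fact n * fps_nth X n = f n) \<Longrightarrow> egf f = X"
  by (rule fps_ext) (simp add: field_simps flip: mult.commute)

lemma egf_mult_nth:
  "fact n * fps_nth (egf f * egf g) n = (\<Sum>k=0..n. of_nat (n choose k) * f (n - k) * g k)"
proof -
  have "fact n * fps_nth (egf f * egf g) n
      = (\<Sum>k=0..n. fact n * (g k / fact k * (f (n - k) / fact (n - k))))"
    by (simp add: mult.commute[of "egf f"] fps_mult_nth sum_distrib_left)
  also have "\<dots> = (\<Sum>k=0..n. of_nat (n choose k) * f (n - k) * g k)"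
    by (rule sum.cong) (auto simp: binomial_fact field_simps)
  finally show ?thesis .
qed

text \<open>A composition of \<open>n\<close> is a first part \<open>k\<close> and a composition of \<open>n - k\<close>; with \<open>g\<close> the
  sum of the remaining parts, this turns sums over compositions with any number of parts into
  iterated Cauchy products.\<close>

lemma sum_composition_Cons:
  fixes g :: "'b \<Rightarrow> nat" and h :: "nat \<Rightarrow> 'b \<Rightarrow> 'c::comm_monoid_add"
  assumes "\<And>m. finite {y. g y = m}"
  shows "(\<Sum>(k, y) \<in> {(k, y). k + g y = n}. h k y) = (\<Sum>k=0..n. \<Sum>y\<in>{y. g y = n - k}. h k y)"
proof -
  have "{(k, y). k + g y = n} = (SIGMA k:{0..n}. {y. g y = n - k})"
    by auto
  then show ?thesis
    using assms by (simp add: sum.Sigma)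
qed

lemma finite_composition_Cons:
  fixes g :: "'b \<Rightarrow> nat"
  assumes "\<And>m. finite {y. g y = m}"
  shows "finite {(k, y). k + g y = n}"
proof -
  have "{(k, y). k + g y = n} = (SIGMA k:{0..n}. {y. g y = n - k})"
    by auto
  then show ?thesis
    using assms by simp
qed

lemma finite_compositions:
  "finite {(k1 :: nat, k2). k1 + k2 = n}"
  "finite {(k1 :: nat, k2, k3). k1 + k2 + k3 = n}"
proof -
  have 2: "finite {(k1 :: nat, k2). k1 + k2 = m}" for m
    using finite_composition_Cons[of "\<lambda>k. k" m] by simp
  then show "finite {(k1 :: nat, k2). k1 + k2 = n}" .
  show "finite {(k1 :: nat, k2, k3). k1 + k2 + k3 = n}"
    using finite_composition_Cons[of "\<lambda>(k2, k3). k2 + k3" n] 2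
    by (simp add: case_prod_unfold add.assoc)
qed

lemma fps_mult2_nth:
  fixes X Y :: "'a::comm_semiring_1 fps"
  shows "fps_nth (X * Y) n = (\<Sum>(k1, k2) \<in> {(k1, k2). k1 + k2 = n}. fps_nth X k1 * fps_nth Y k2)"
  using sum_composition_Cons[of "\<lambda>k. k" "\<lambda>k1 k2. fps_nth X k1 * fps_nth Y k2" n]
  by (simp add: fps_mult_nth)

lemma fps_mult3_nth:
  fixes X Y Z :: "'a::comm_semiring_1 fps"
  shows "fps_nth (X * Y * Z) n =
    (\<Sum>(k1, k2, k3) \<in> {(k1, k2, k3). k1 + k2 + k3 = n}. fps_nth X k1 * fps_nth Y k2 * fps_nth Z k3)"
proof -
  have "fps_nth (X * (Y * Z)) n = (\<Sum>k=0..n. \<Sum>y\<in>{y. (case y of (k2, k3) \<Rightarrow> k2 + k3) = n - k}.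
      fps_nth X k * (case y of (k2, k3) \<Rightarrow> fps_nth Y k2 * fps_nth Z k3))"
    unfolding fps_mult_nth[of X] fps_mult2_nth[of Y Z] by (simp add: sum_distrib_left case_prod_unfold)
  also have "\<dots> = (\<Sum>(k, y)\<in>{(k, y). k + (case y of (k2, k3) \<Rightarrow> k2 + k3) = n}.
      fps_nth X k * (case y of (k2, k3) \<Rightarrow> fps_nth Y k2 * fps_nth Z k3))"
    using finite_compositions(1)
    by (intro sum_composition_Cons[symmetric]) (simp add: case_prod_unfold)
  finally show ?thesis
    by (simp add: case_prod_unfold add.assoc mult.assoc)
qed

lemma fps_mult4_nth:
  fixes X Y Z W :: "'a::comm_semiring_1 fps"
  shows "fps_nth (X * Y * Z * W) n =
    (\<Sum>(k1, k2, k3, k4) \<in> {(k1, k2, k3, k4). k1 + k2 + k3 + k4 = n}.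
       fps_nth X k1 * fps_nth Y k2 * fps_nth Z k3 * fps_nth W k4)"
proof -
  have "fps_nth (X * (Y * Z * W)) n = (\<Sum>k=0..n. \<Sum>y\<in>{y. (case y of (k2, k3, k4) \<Rightarrow> k2 + k3 + k4) = n - k}.
      fps_nth X k * (case y of (k2, k3, k4) \<Rightarrow> fps_nth Y k2 * fps_nth Z k3 * fps_nth W k4))"
    unfolding fps_mult_nth[of X] fps_mult3_nth[of Y Z W] by (simp add: sum_distrib_left case_prod_unfold)
  also have "\<dots> = (\<Sum>(k, y)\<in>{(k, y). k + (case y of (k2, k3, k4) \<Rightarrow> k2 + k3 + k4) = n}.
      fps_nth X k * (case y of (k2, k3, k4) \<Rightarrow> fps_nth Y k2 * fps_nth Z k3 * fps_nth W k4))"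
    using finite_compositions(2)
    by (intro sum_composition_Cons[symmetric]) (simp add: case_prod_unfold)
  finally show ?thesis
    by (simp add: case_prod_unfold add.assoc mult.assoc)
qed

lemma egf_mult3_nth:
  "fact n * fps_nth (egf f * egf g * egf h) n =
     (\<Sum>(k1, k2, k3) \<in> {(k1, k2, k3). k1 + k2 + k3 = n}.
        multinomial n [k1, k2, k3] * f k1 * g k2 * h k3)"
  unfolding fps_mult3_nth sum_distrib_left
  by (rule sum.cong) (auto simp: multinomial_def mult.assoc)

lemma egf_mult4_nth:
  "fact n * fps_nth (egf f * egf g * egf h * egf u) n =
     (\<Sum>(k1, k2, k3, k4) \<in> {(k1, k2, k3, k4). k1 + k2 + k3 + k4 = n}.
        multinomial n [k1, k2, k3, k4] * f k1 * g k2 * h k3 * u k4)"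
  unfolding fps_mult4_nth sum_distrib_left
  by (rule sum.cong) (auto simp: multinomial_def mult.assoc)


section \<open>Binet formulas\<close>

lemma eq_tetraI:
  fixes f :: "nat \<Rightarrow> 'a::comm_monoid_add"
  assumes "f 0 = s0" "f 1 = s1" "f 2 = s2" "f 3 = s3"
    and "\<And>n. f (n + 4) = f (n + 3) + f (n + 2) + f (n + 1) + f n"
  shows "f n = tetra s0 s1 s2 s3 n"
  using assms
  by (induction s0 s1 s2 s3 n rule: tetra.induct) (simp_all add: numeral_eq_Suc)

lemma mult_tetra:
  fixes c :: "'a::semiring_0"
  shows "c * tetra s0 s1 s2 s3 n = tetra (c * s0) (c * s1) (c * s2) (c * s3) n"
  by (induction s0 s1 s2 s3 n rule: tetra.induct) (simp_all add: distrib_left)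

text \<open>At a root \<open>x\<close> of \<open>f = X\<^sup>4 - X\<^sup>3 - X\<^sup>2 - X - 1\<close>, the denominator \<open>- x\<^sup>3 + 6 x - 1\<close> of the
  Binet coefficient equals \<open>f'(x) / x\<^sup>2\<close>. As \<open>f\<close> has discriminant \<open>-563\<close>, this is invertible modulo
  \<open>f\<close>, and the coefficient and its powers are cubic polynomials in \<open>x\<close> with denominators dividing
  powers of 563. Reduction modulo \<open>f\<close> cancels one factor 563 from the denominators of the square and
  the cube and two from that of the fourth power.\<close>

lemma binet_coeff_root:
  assumes x: "x ^ 4 = x ^ 3 + x ^ 2 + x + (1::complex)"
  shows "(- (x ^ 3) + 6 * x - 1) * binet_coeff x = 1"
    and "563 * binet_coeff x = - 87 - 71 * x - 61 * x ^ 2 + 86 * x ^ 3"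
    and "563 * binet_coeff x ^ 2 = 6 + 9 * x + 28 * x ^ 2 - 11 * x ^ 3"
    and "563 ^ 2 * binet_coeff x ^ 3 = 512 + 1958 * x - 1220 * x ^ 2 + 1157 * x ^ 3"
    and "563 ^ 2 * binet_coeff x ^ 4 = 248 - 175 * x + 255 * x ^ 2 + 210 * x ^ 3"
proof -
  have inv: "(- (x ^ 3) + 6 * x - 1) * (- 87 - 71 * x - 61 * x ^ 2 + 86 * x ^ 3) = 563"
    using x by algebra
  then show c: "(- (x ^ 3) + 6 * x - 1) * binet_coeff x = 1"
    by (auto simp: binet_coeff_def)
  from c inv show c1: "563 * binet_coeff x = - 87 - 71 * x - 61 * x ^ 2 + 86 * x ^ 3"
    by algebra
  have "563 * (563 * binet_coeff x ^ 2) = (563 * binet_coeff x) ^ 2"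
    by (simp add: power2_eq_square)
  also have "\<dots> = 563 * (6 + 9 * x + 28 * x ^ 2 - 11 * x ^ 3)"
    unfolding c1 using x by algebra
  finally show c2: "563 * binet_coeff x ^ 2 = 6 + 9 * x + 28 * x ^ 2 - 11 * x ^ 3"
    by (simp only: mult_cancel_left) simp
  have "563 ^ 2 * binet_coeff x ^ 3 = (563 * binet_coeff x ^ 2) * (563 * binet_coeff x)"
    by (simp add: power2_eq_square power3_eq_cube)
  also have "\<dots> = 512 + 1958 * x - 1220 * x ^ 2 + 1157 * x ^ 3"
    unfolding c1 c2 using x by algebra
  finally show "563 ^ 2 * binet_coeff x ^ 3 = 512 + 1958 * x - 1220 * x ^ 2 + 1157 * x ^ 3" .
  have "563 ^ 2 * binet_coeff x ^ 4 = (563 * binet_coeff x ^ 2) ^ 2"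
    by (simp add: power_mult_distrib)
  also have "\<dots> = 248 - 175 * x + 255 * x ^ 2 + 210 * x ^ 3"
    unfolding c2 using x by algebra
  finally show "563 ^ 2 * binet_coeff x ^ 4 = 248 - 175 * x + 255 * x ^ 2 + 210 * x ^ 3" .
qed

locale tetranacci_roots =
  fixes \<alpha> \<beta> \<gamma> \<delta> :: complex
  assumes root: "x \<in> {\<alpha>, \<beta>, \<gamma>, \<delta>} \<Longrightarrow> x ^ 4 = x ^ 3 + x ^ 2 + x + 1"
    and distinct: "distinct [\<alpha>, \<beta>, \<gamma>, \<delta>]"
begin

abbreviation R :: "complex set" where
  "R \<equiv> {\<alpha>, \<beta>, \<gamma>, \<delta>}"

lemma sum_R: "(\<Sum>x\<in>R. f x) = f \<alpha> + f \<beta> + f \<gamma> + f \<delta>"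
  using distinct by (simp add: add.assoc)

text \<open>The Vieta relations come from divided differences: dividing \<open>f(x) - f(y) = 0\<close> by \<open>x - y\<close>
  lowers the degree, and three divisions leave the sum of the roots.\<close>

lemma sum_roots: "\<alpha> + \<beta> + \<gamma> + \<delta> = 1"
  and sum_roots2: "\<alpha>\<^sup>2 + \<beta>\<^sup>2 + \<gamma>\<^sup>2 + \<delta>\<^sup>2 = 3"
  and sum_roots3: "\<alpha> ^ 3 + \<beta> ^ 3 + \<gamma> ^ 3 + \<delta> ^ 3 = 7"
proof -
  have f: "\<alpha> ^ 4 = \<alpha> ^ 3 + \<alpha> ^ 2 + \<alpha> + 1" "\<beta> ^ 4 = \<beta> ^ 3 + \<beta> ^ 2 + \<beta> + 1"
    "\<gamma> ^ 4 = \<gamma> ^ 3 + \<gamma> ^ 2 + \<gamma> + 1" "\<delta> ^ 4 = \<delta> ^ 3 + \<delta> ^ 2 + \<delta> + 1"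
    by (simp_all add: root)
  \<comment> \<open>\<open>d1\<close>, \<open>d2\<close> and the final equation for \<open>\<gamma> - \<delta>\<close> are the first, second and third divided
    differences of the quartic.\<close>
  have d1: "\<alpha>^3 + \<alpha>^2*y + \<alpha>*y^2 + y^3 = \<alpha>^2 + \<alpha>*y + y^2 + \<alpha> + y + 1"
    if "y \<noteq> \<alpha>" "y ^ 4 = y ^ 3 + y ^ 2 + y + 1" for y
  proof -
    have "(\<alpha> - y) * (\<alpha>^3 + \<alpha>^2*y + \<alpha>*y^2 + y^3 - (\<alpha>^2 + \<alpha>*y + y^2 + \<alpha> + y + 1)) = 0"
      using f(1) that(2) by algebra
    then show ?thesis using that(1) by simp
  qed
  have d2: "\<alpha>^2 + \<beta>^2 + y^2 + \<alpha>*\<beta> + \<alpha>*y + \<beta>*y = \<alpha> + \<beta> + y + 1"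
    if "y \<noteq> \<alpha>" "y \<noteq> \<beta>" "y ^ 4 = y ^ 3 + y ^ 2 + y + 1" for y
  proof -
    have "(\<beta> - y) * (\<alpha>^2 + \<beta>^2 + y^2 + \<alpha>*\<beta> + \<alpha>*y + \<beta>*y - (\<alpha> + \<beta> + y + 1)) = 0"
    proof -
      have "\<alpha>^3 + \<alpha>^2*\<beta> + \<alpha>*\<beta>^2 + \<beta>^3 = \<alpha>^2 + \<alpha>*\<beta> + \<beta>^2 + \<alpha> + \<beta> + 1"
        using d1[of \<beta>] f(2) distinct by auto
      with d1[of y] that show ?thesis by algebra
    qed
    then show ?thesis using that(2) by simp
  qed
  have d3: "\<alpha>^2 + \<beta>^2 + \<gamma>^2 + \<alpha>*\<beta> + \<alpha>*\<gamma> + \<beta>*\<gamma> = \<alpha> + \<beta> + \<gamma> + 1"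
    using d2[of \<gamma>] f(3) distinct by auto
  have "(\<gamma> - \<delta>) * (\<alpha> + \<beta> + \<gamma> + \<delta> - 1) = 0"
  proof -
    have "\<alpha>^2 + \<beta>^2 + \<delta>^2 + \<alpha>*\<beta> + \<alpha>*\<delta> + \<beta>*\<delta> = \<alpha> + \<beta> + \<delta> + 1"
      using d2[of \<delta>] f(4) distinct by auto
    with d3 show ?thesis by algebra
  qed
  then show s1: "\<alpha> + \<beta> + \<gamma> + \<delta> = 1"
    using distinct by simp
  have dlt: "\<delta> = 1 - \<alpha> - \<beta> - \<gamma>"
    using s1 by (simp add: algebra_simps)
  show "\<alpha>\<^sup>2 + \<beta>\<^sup>2 + \<gamma>\<^sup>2 + \<delta>\<^sup>2 = 3"
    unfolding dlt using d3 by algebra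
  have "\<alpha>^3 + \<alpha>^2*\<beta> + \<alpha>*\<beta>^2 + \<beta>^3 = \<alpha>^2 + \<alpha>*\<beta> + \<beta>^2 + \<alpha> + \<beta> + 1"
    using d1[of \<beta>] f(2) distinct by auto
  then show "\<alpha> ^ 3 + \<beta> ^ 3 + \<gamma> ^ 3 + \<delta> ^ 3 = 7"
    unfolding dlt using d3 by algebra
qed

lemma root_power_shift: "x \<in> R \<Longrightarrow> x ^ (n + 4) = x ^ (n + 3) + x ^ (n + 2) + x ^ (n + 1) + x ^ n"
  using root[of x] by (simp add: power_add power2_eq_square power3_eq_cube algebra_simps)

text \<open>This is the source of all initial values in the theorem. A sum over the roots of a cubic
  weight times \<open>x\<^sup>n\<close> is a combination of shifted power sums of the roots, which are
  \<open>4, 1, 3, 7, 15, 26, 51\<close> for the exponents 0 to 6. The scalar \<open>c\<close> clears denominators.\<close>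

lemma root_sum_eq_tetra:
  assumes "\<And>x. x \<in> R \<Longrightarrow> c * g x = u0 + u1 * x + u2 * x ^ 2 + u3 * x ^ 3"
  shows "c * (\<Sum>x\<in>R. g x * x ^ n) =
    tetra (4 * u0 + u1 + 3 * u2 + 7 * u3) (u0 + 3 * u1 + 7 * u2 + 15 * u3)
      (3 * u0 + 7 * u1 + 15 * u2 + 26 * u3) (7 * u0 + 15 * u1 + 26 * u2 + 51 * u3) n"
proof -
  define s where "s n = (\<Sum>x\<in>R. x ^ n)" for n :: nat
  have rec: "s (n + 4) = s (n + 3) + s (n + 2) + s (n + 1) + s n" for n
    unfolding s_def sum.distrib[symmetric] by (rule sum.cong) (simp_all add: root_power_shift)
  have s0123: "s 0 = 4" "s 1 = 1" "s 2 = 3" "s 3 = 7"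
    using sum_roots sum_roots2 sum_roots3 by (simp_all add: s_def sum_R del: sum_constant)
  have s456: "s 4 = 15" "s 5 = 26" "s 6 = 51"
    using rec[of 0] rec[of 1] rec[of 2] s0123 by (simp_all add: numeral_eq_Suc)
  have sum: "c * (\<Sum>x\<in>R. g x * x ^ n) = u0 * s n + u1 * s (n + 1) + u2 * s (n + 2) + u3 * s (n + 3)" for n
  proof -
    have "c * (\<Sum>x\<in>R. g x * x ^ n)
        = (\<Sum>x\<in>R. u0 * x ^ n + u1 * x ^ (n + 1) + u2 * x ^ (n + 2) + u3 * x ^ (n + 3))"
      unfolding sum_distrib_left mult.assoc[symmetric]
      by (rule sum.cong) (simp_all only: assms power_add power_one_right algebra_simps)
    then show ?thesis
      by (simp only: s_def sum.distrib sum_distrib_left)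
  qed
  show ?thesis
    unfolding sum
  proof (rule eq_tetraI)
    fix n
    have rec': "s (n + 4 + j) = s (n + 3 + j) + s (n + 2 + j) + s (n + 1 + j) + s (n + j)" for j
      using rec[of "n + j"] by (simp only: ac_simps)
    show "u0 * s (n + 4) + u1 * s (n + 4 + 1) + u2 * s (n + 4 + 2) + u3 * s (n + 4 + 3)
      = u0 * s (n + 3) + u1 * s (n + 3 + 1) + u2 * s (n + 3 + 2) + u3 * s (n + 3 + 3)
      + (u0 * s (n + 2) + u1 * s (n + 2 + 1) + u2 * s (n + 2 + 2) + u3 * s (n + 2 + 3))
      + (u0 * s (n + 1) + u1 * s (n + 1 + 1) + u2 * s (n + 1 + 2) + u3 * s (n + 1 + 3))
      + (u0 * s n + u1 * s (n + 1) + u2 * s (n + 2) + u3 * s (n + 3))"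
      unfolding rec[of n] rec' by (simp only: algebra_simps)
  qed (use s0123 s456 in \<open>simp_all add: numeral_eq_Suc\<close>)
qed

lemma binet1: "(\<Sum>x\<in>R. binet_coeff x * x ^ n) = tetranacci n"
proof -
  have "563 * (\<Sum>x\<in>R. binet_coeff x * x ^ n) = 563 * tetra 0 1 1 2 n"
    using root_sum_eq_tetra[of 563 binet_coeff "-87" "-71" "-61" 86 n]
      binet_coeff_root(2)[OF root]
    by (simp add: mult_tetra)
  then show ?thesis
    by (simp add: tetranacci_def)
qed

lemma binet2: "563 * (\<Sum>x\<in>R. binet_coeff x ^ 2 * x ^ n) = tetra 40 64 215 344 n"
  using root_sum_eq_tetra[of 563 "\<lambda>x. binet_coeff x ^ 2" 6 9 28 "-11" n]
    binet_coeff_root(3)[OF root]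
  by simp

lemma binet3: "563 * (\<Sum>x\<in>R. binet_coeff x ^ 3 * x ^ n) = tetra 15 27 48 107 n"
proof -
  have "563 ^ 2 * (\<Sum>x\<in>R. binet_coeff x ^ 3 * x ^ n) = 563 * tetra 15 27 48 107 n"
    using root_sum_eq_tetra[of "563 ^ 2" "\<lambda>x. binet_coeff x ^ 3" 512 1958 "-1220" 1157 n]
      binet_coeff_root(4)[OF root]
    by (simp add: mult_tetra)
  then show ?thesis
    by (simp add: power2_eq_square)
qed

lemma binet4: "563 ^ 2 * (\<Sum>x\<in>R. binet_coeff x ^ 4 * x ^ n) = tetra 3052 4658 8804 16451 n"
  using root_sum_eq_tetra[of "563 ^ 2" "\<lambda>x. binet_coeff x ^ 4" 248 "-175" 255 210 n]
    binet_coeff_root(5)[OF root]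
  by simp

lemma binet_inverse: "(\<Sum>x\<in>R. (- (x ^ 3) + 6 * x - 1) * x ^ n) = tetra (- 5) 2 13 32 n"
  using root_sum_eq_tetra[of 1 "\<lambda>x. - (x ^ 3) + 6 * x - 1" "-1" 6 0 "-1" n]
  by simp

text \<open>The \<open>c\<^sub>i\<close> have the power sums \<open>0\<close>, \<open>40/563\<close> and \<open>3052/563\<^sup>2\<close> of orders 1, 2 and 4, by
  the Binet formulas at \<open>n = 0\<close>. If \<open>p\<^sub>1 = 0\<close>, Newton's identities reduce to
  \<open>24 e\<^sub>4 = 3 p\<^sub>2\<^sup>2 - 6 p\<^sub>4\<close>.\<close>

lemma prod_binet_coeff:
  "binet_coeff \<alpha> * binet_coeff \<beta> * binet_coeff \<gamma> * binet_coeff \<delta> = - 1 / 563"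
proof -
  define a b c d where "a = binet_coeff \<alpha>" "b = binet_coeff \<beta>" "c = binet_coeff \<gamma>" "d = binet_coeff \<delta>"
  have 1: "a + b + c + d = 0"
    using binet1[of 0] by (simp add: sum_R a_b_c_d_def tetranacci_def)
  have 2: "563 * (a ^ 2 + b ^ 2 + c ^ 2 + d ^ 2) = 40"
    using binet2[of 0] by (simp add: sum_R a_b_c_d_def)
  have 3: "563 ^ 2 * (a ^ 4 + b ^ 4 + c ^ 4 + d ^ 4) = 3052"
    using binet4[of 0] by (simp add: sum_R a_b_c_d_def)
  have d: "d = - a - b - c" using 1 by algebra
  have "24 * (a * b * c * d) = 3 * (a ^ 2 + b ^ 2 + c ^ 2 + d ^ 2) ^ 2 - 6 * (a ^ 4 + b ^ 4 + c ^ 4 + d ^ 4)"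
    unfolding d by algebra
  also have "\<dots> = 24 * (- 1 / 563)"
  proof -
    have *: "a ^ 2 + b ^ 2 + c ^ 2 + d ^ 2 = 40 / 563" "a ^ 4 + b ^ 4 + c ^ 4 + d ^ 4 = 3052 / 563 ^ 2"
      using 2 3 by (simp_all add: field_simps)
    show ?thesis unfolding * by (simp add: field_simps)
  qed
  finally show ?thesis
    by (simp only: a_b_c_d_def mult_cancel_left) simp
qed

end


section \<open>Symmetric products of degree four\<close>

text \<open>The expansions have integer coefficients except for \<open>e\<^sub>2\<^sup>2\<close>, which involves
  \<open>\<Sum> a\<^sup>2b\<^sup>2 = (p\<^sub>2\<^sup>2 - p\<^sub>4) / 2\<close>; hence the factor 2 there.\<close>

lemma symmetric_products:
  fixes a b c d :: "'a::comm_ring_1"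
  defines "p k \<equiv> a ^ k + b ^ k + c ^ k + d ^ k"
    and "e2 \<equiv> a * b + a * c + a * d + b * c + b * d + c * d"
    and "e3 \<equiv> a * b * c + a * b * d + a * c * d + b * c * d"
    and "e4 \<equiv> a * b * c * d"
    and "m \<equiv> a * b * c * (a + b + c) + b * c * d * (b + c + d)
      + a * b * d * (a + b + d) + a * c * d * (a + c + d)"
  shows "p 1 * p 1 * p 1 * p 1 = 4 * (p 3 * p 1) + 3 * (p 2 * p 2) - 6 * p 4 + 12 * m + 24 * e4"
    and "p 2 * e2 = p 3 * p 1 - p 4 + m"
    and "2 * (e2 * e2) = p 2 * p 2 - p 4 + 4 * m + 12 * e4"
    and "p 2 * p 1 * p 1 = 2 * (p 3 * p 1) + p 2 * p 2 - 2 * p 4 + 2 * m"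
    and "e2 * p 1 * p 1 = p 3 * p 1 + p 2 * p 2 - 2 * p 4 + 5 * m + 12 * e4"
    and "e3 * p 1 = m + 4 * e4"
    and "2 * e2 = p 1 * p 1 - p 2"
  unfolding p_def e2_def e3_def e4_def m_def by (simp_all add: algebra_simps power2_eq_square power3_eq_cube power4_eq_xxxx)


section \<open>Generating functions of the Tetranacci sequences\<close>

context tetranacci_roots
begin

definition binet_term :: "complex \<Rightarrow> complex fps" where
  "binet_term x = fps_const (binet_coeff x) * fps_exp x"

abbreviation power_sum :: "nat \<Rightarrow> complex fps" where
  "power_sum k \<equiv> binet_term \<alpha> ^ k + binet_term \<beta> ^ k + binet_term \<gamma> ^ k + binet_term \<delta> ^ k"

abbreviation e2 :: "complex fps" where
  "e2 \<equiv> binet_term \<alpha> * binet_term \<beta> + binet_term \<alpha> * binet_term \<gamma> + binet_term \<alpha> * binet_term \<delta>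
    + binet_term \<beta> * binet_term \<gamma> + binet_term \<beta> * binet_term \<delta> + binet_term \<gamma> * binet_term \<delta>"

abbreviation e3 :: "complex fps" where
  "e3 \<equiv> binet_term \<alpha> * binet_term \<beta> * binet_term \<gamma> + binet_term \<alpha> * binet_term \<beta> * binet_term \<delta>
    + binet_term \<alpha> * binet_term \<gamma> * binet_term \<delta> + binet_term \<beta> * binet_term \<gamma> * binet_term \<delta>"

abbreviation e4 :: "complex fps" where
  "e4 \<equiv> binet_term \<alpha> * binet_term \<beta> * binet_term \<gamma> * binet_term \<delta>"

lemma power_sum_nth:
  "fact n * fps_nth (power_sum k) n = of_nat k ^ n * (\<Sum>x\<in>R. binet_coeff x ^ k * x ^ n)"
proof -
  have "binet_term x ^ k = fps_const (binet_coeff x ^ k) * fps_exp (of_nat k * x)" for x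
    by (simp add: binet_term_def power_mult_distrib fps_const_power fps_exp_power_mult)
  then show ?thesis
    by (simp add: sum_R power_mult_distrib algebra_simps)
qed

lemma egf_tetranacci: "egf tetranacci = power_sum 1"
  by (rule egf_eqI, subst power_sum_nth) (simp flip: binet1)

lemma numeral_power_sum_nth:
  "fact n * fps_nth (numeral c * power_sum k) n
     = numeral c * (of_nat k ^ n * (\<Sum>x\<in>R. binet_coeff x ^ k * x ^ n))"
  unfolding numeral_fps_const fps_mult_left_const_nth power_sum_nth[symmetric] by (simp only: mult_ac)

lemma egf_power_sum2: "egf (\<lambda>n. 2 ^ n * tetra 40 64 215 344 n) = 563 * power_sum 2"
  by (rule egf_eqI) (simp only: numeral_power_sum_nth flip: binet2, simp)

lemma egf_power_sum3: "egf (\<lambda>n. 3 ^ n * tetra 15 27 48 107 n) = 563 * power_sum 3"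
  by (rule egf_eqI) (simp only: numeral_power_sum_nth flip: binet3, simp)

lemma egf_tetra_t: "egf tetra_t = e2"
proof -
  have "2 * egf tetra_t = power_sum 1 * power_sum 1 - power_sum 2"
  proof (rule fps_ext)
    fix n
    have "fact n * fps_nth (power_sum 1 * power_sum 1) n
        = (\<Sum>k=0..n. of_nat (n choose k) * tetranacci k * tetranacci (n - k))"
      unfolding egf_tetranacci[symmetric] mult.commute[of "tetranacci k" for k] egf_mult_nth
      by (simp add: mult_ac)
    moreover have "fact n * fps_nth (power_sum 2) n = 2 ^ n / 563 * tetra 40 64 215 344 n"
      unfolding power_sum_nth binet2[symmetric] by simp
    ultimately have "fact n * fps_nth (power_sum 1 * power_sum 1 - power_sum 2) n = 2 * tetra_t n"
      by (simp add: tetra_t_def algebra_simps)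
    then show "fps_nth (2 * egf tetra_t) n = fps_nth (power_sum 1 * power_sum 1 - power_sum 2) n"
      by (simp add: field_simps numeral_fps_const)
  qed
  also have "\<dots> = 2 * e2"
    by (simp only: symmetric_products(7))
  finally show ?thesis
    by (simp only: mult_cancel_left) simp
qed

lemma egf_one: "egf (\<lambda>_. 1) = - 563 * e4"
proof -
  have "e4 = fps_const (binet_coeff \<alpha> * binet_coeff \<beta> * binet_coeff \<gamma> * binet_coeff \<delta>)
      * fps_exp (\<alpha> + \<beta> + \<gamma> + \<delta>)"
    unfolding binet_term_def fps_exp_add_mult fps_const_mult[symmetric] by (simp only: mult_ac)
  then have "fps_const (- 563) * e4 = fps_exp 1"
    unfolding prod_binet_coeff sum_roots by (simp flip: mult.assoc)
  then have "- 563 * e4 = fps_exp 1"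
    by (simp add: numeral_fps_const)
  moreover have "egf (\<lambda>_. 1) = fps_exp 1"
    by (rule fps_ext) simp
  ultimately show ?thesis
    by simp
qed

text \<open>If \<open>w\<close> is the root missing from \<open>x, y, z\<close>, then \<open>x + y + z = 1 - w\<close>, and
  \<open>c\<^sub>x c\<^sub>y c\<^sub>z = - 1 / (563 c\<^sub>w)\<close>, where \<open>1 / c\<^sub>w = - w\<^sup>3 + 6 w - 1\<close> is polynomial in \<open>w\<close>. So
  \<open>e\<^sub>3\<close> is a sum over single roots \<open>w\<close>, with the exponentials \<open>e\<^bsup>-wx\<^esup> e\<^sup>x\<close>.\<close>

lemma egf_e3: "egf (\<lambda>n. (- 1) ^ n * tetra (- 5) 2 13 32 n) * egf (\<lambda>_. 1) = - 563 * e3"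
proof -
  let ?q = "\<lambda>x::complex. - (x ^ 3) + 6 * x - 1"
  have triple: "- 563 * (binet_term x * binet_term y * binet_term z)
      = fps_const (?q w) * fps_exp (- w) * fps_exp 1"
    if "x + y + z + w = 1" "binet_coeff x * binet_coeff y * binet_coeff z * binet_coeff w = - 1 / 563"
      "w \<in> R" for x y z w
  proof -
    have "- 563 * (binet_coeff x * binet_coeff y * binet_coeff z)
      = - 563 * (binet_coeff x * binet_coeff y * binet_coeff z * binet_coeff w) * ?q w"
      using binet_coeff_root(1)[OF root[OF that(3)]] by algebra
    then have c: "- 563 * (binet_coeff x * binet_coeff y * binet_coeff z) = ?q w"
      unfolding that(2) by simp
    have "- 563 * (binet_term x * binet_term y * binet_term z)
        = fps_const (- 563) * (binet_term x * binet_term y * binet_term z)"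
      by (simp add: numeral_fps_const)
    also have "\<dots> = fps_const (- 563 * (binet_coeff x * binet_coeff y * binet_coeff z)) * fps_exp (x + y + z)"
      unfolding binet_term_def fps_exp_add_mult fps_const_mult[symmetric] by (simp only: mult_ac)
    also have "x + y + z = - w + 1"
      using that(1) by (simp add: algebra_simps)
    finally show ?thesis
      unfolding c fps_exp_add_mult by (simp add: mult.assoc)
  qed
  have "egf (\<lambda>n. (- 1) ^ n * tetra (- 5) 2 13 32 n) = (\<Sum>x\<in>R. fps_const (?q x) * fps_exp (- x))"
  proof (rule egf_eqI)
    fix n
    show "fact n * fps_nth (\<Sum>x\<in>R. fps_const (?q x) * fps_exp (- x)) n
      = (- 1) ^ n * tetra (- 5) 2 13 32 n"
      unfolding binet_inverse[symmetric] fps_sum_nth sum_distrib_left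
      by (rule sum.cong) (simp_all add: mult.left_commute[of "fact n"] flip: power_mult_distrib)
  qed
  moreover have "egf (\<lambda>_. 1) = fps_exp 1"
    by (rule fps_ext) simp
  ultimately have "egf (\<lambda>n. (- 1) ^ n * tetra (- 5) 2 13 32 n) * egf (\<lambda>_. 1)
      = (\<Sum>x\<in>R. fps_const (?q x) * fps_exp (- x) * fps_exp 1)"
    by (simp only: sum_distrib_right)
  also have "\<dots> = - 563 * (binet_term \<beta> * binet_term \<gamma> * binet_term \<delta>)
      + - 563 * (binet_term \<alpha> * binet_term \<gamma> * binet_term \<delta>)
      + - 563 * (binet_term \<alpha> * binet_term \<beta> * binet_term \<delta>)
      + - 563 * (binet_term \<alpha> * binet_term \<beta> * binet_term \<gamma>)"
  proof -
    have "- 563 * (binet_term \<beta> * binet_term \<gamma> * binet_term \<delta>)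
          = fps_const (?q \<alpha>) * fps_exp (- \<alpha>) * fps_exp 1"
      "- 563 * (binet_term \<alpha> * binet_term \<gamma> * binet_term \<delta>)
          = fps_const (?q \<beta>) * fps_exp (- \<beta>) * fps_exp 1"
      "- 563 * (binet_term \<alpha> * binet_term \<beta> * binet_term \<delta>)
          = fps_const (?q \<gamma>) * fps_exp (- \<gamma>) * fps_exp 1"
      "- 563 * (binet_term \<alpha> * binet_term \<beta> * binet_term \<gamma>)
          = fps_const (?q \<delta>) * fps_exp (- \<delta>) * fps_exp 1"
      by (rule triple; use sum_roots prod_binet_coeff in \<open>simp add: ac_simps\<close>)+
    then show ?thesis
      by (simp only: sum_R)
  qed
  finally show ?thesis
    by (simp only: distrib_left add_ac)
qed

lemma t1_series_eq:
  "t1_series \<alpha> \<beta> \<gamma> \<delta> =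
     binet_term \<alpha> * binet_term \<beta> * binet_term \<gamma> * (binet_term \<alpha> + binet_term \<beta> + binet_term \<gamma>)
     + binet_term \<beta> * binet_term \<gamma> * binet_term \<delta> * (binet_term \<beta> + binet_term \<gamma> + binet_term \<delta>)
     + binet_term \<alpha> * binet_term \<beta> * binet_term \<delta> * (binet_term \<alpha> + binet_term \<beta> + binet_term \<delta>)
     + binet_term \<alpha> * binet_term \<gamma> * binet_term \<delta> * (binet_term \<alpha> + binet_term \<gamma> + binet_term \<delta>)"
  unfolding t1_series_def Let_def binet_term_def fps_exp_add_mult by (simp only: mult_ac)

end


section \<open>The expansion of the fourfold convolution\<close>

theorem theorem5:
  fixes \<alpha> \<beta> \<gamma> \<delta> A B C D E F G H I J :: complex and n :: nat
  assumes roots: "{x :: complex. x ^ 4 - x ^ 3 - x ^ 2 - x - 1 = 0} = {\<alpha>, \<beta>, \<gamma>, \<delta>}"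
    and distinct: "distinct [\<alpha>, \<beta>, \<gamma>, \<delta>]"
    and A: "A = - D + E + G + H - 3"
    and B: "B = 12 * D + 12 * G - 4 * J - 12"
    and C: "C = - E - 2 * G - H + 4"
    and F: "F = - 2 * D - 2 * G - 2 * H + 6"
    and I: "I = 4 * D - E + 2 * G - H - J"
    and I_nonzero: "I \<noteq> 0"
  shows "I * t1 \<alpha> \<beta> \<gamma> \<delta> n =
      (\<Sum>(k1, k2, k3, k4) \<in> {(k1, k2, k3, k4). k1 + k2 + k3 + k4 = n}.
         multinomial n [k1, k2, k3, k4]
           * tetranacci k1 * tetranacci k2 * tetranacci k3 * tetranacci k4)
    - A / 563 ^ 2 * 4 ^ n * tetra 3052 4658 8804 16451 n
    + B / 563
    - C / 563 * (\<Sum>k=0..n. of_nat (n choose k) * 3 ^ (n - k)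
                   * tetra 15 27 48 107 (n - k) * tetranacci k)
    - D / 563 ^ 2 * (\<Sum>k=0..n. of_nat (n choose k) * 2 ^ n
                   * tetra 40 64 215 344 (n - k) * tetra 40 64 215 344 k)
    - E / 563 * (\<Sum>k=0..n. of_nat (n choose k) * 2 ^ (n - k)
                   * tetra 40 64 215 344 (n - k) * tetra_t k)
    - F * (\<Sum>k=0..n. of_nat (n choose k) * tetra_t (n - k) * tetra_t k)
    - G / 563 * (\<Sum>(k1, k2, k3) \<in> {(k1, k2, k3). k1 + k2 + k3 = n}.
         multinomial n [k1, k2, k3]
           * 2 ^ k1 * tetra 40 64 215 344 k1 * tetranacci k2 * tetranacci k3)
    - H * (\<Sum>(k1, k2, k3) \<in> {(k1, k2, k3). k1 + k2 + k3 = n}.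
         multinomial n [k1, k2, k3] * tetra_t k1 * tetranacci k2 * tetranacci k3)
    + J / 563 * (\<Sum>(k1, k2, k3) \<in> {(k1, k2, k3). k1 + k2 + k3 = n}.
         multinomial n [k1, k2, k3]
           * (- 1) ^ k1 * tetra (- 5) 2 13 32 k1 * tetranacci k2)"
proof -
  interpret tetranacci_roots \<alpha> \<beta> \<gamma> \<delta>
  proof
    fix x
    assume "x \<in> {\<alpha>, \<beta>, \<gamma>, \<delta>}"
    then have "x ^ 4 - x ^ 3 - x ^ 2 - x - 1 = 0"
      using roots by blast
    then show "x ^ 4 = x ^ 3 + x ^ 2 + x + 1"
      by (simp add: algebra_simps)
  qed (fact distinct)

  \<comment> \<open>Taking \<open>N\<close> of an identity of exponential generating functions yields the identity of the
    sequences that they generate.\<close>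
  define N :: "complex fps \<Rightarrow> complex" where "N X = fact n * fps_nth X n" for X
  have N_linear: "N (X + Y) = N X + N Y" "N (X - Y) = N X - N Y"
    "N (numeral w * X) = numeral w * N X" for X Y w
    by (simp_all add: N_def algebra_simps numeral_fps_const)

  note symm = symmetric_products[of "binet_term \<alpha>" "binet_term \<beta>" "binet_term \<gamma>" "binet_term \<delta>",
      folded t1_series_eq]
  note N_symm = symm(1-6)[THEN arg_cong[of _ _ N], unfolded N_linear]

  have t1: "t1 \<alpha> \<beta> \<gamma> \<delta> n = N (t1_series \<alpha> \<beta> \<gamma> \<delta>)"
    by (simp add: t1_def N_def)
  have p1111: "(\<Sum>(k1, k2, k3, k4) \<in> {(k1, k2, k3, k4). k1 + k2 + k3 + k4 = n}.
         multinomial n [k1, k2, k3, k4]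
           * tetranacci k1 * tetranacci k2 * tetranacci k3 * tetranacci k4)
      = N (power_sum 1 * power_sum 1 * power_sum 1 * power_sum 1)"
    unfolding N_def egf_tetranacci[symmetric] egf_mult4_nth ..
  have p4: "4 ^ n * tetra 3052 4658 8804 16451 n = 563 ^ 2 * N (power_sum 4)"
    unfolding N_def power_sum_nth binet4[symmetric] by simp
  have e4: "1 = - 563 * N e4"
    using arg_cong[OF egf_one, of N] by (simp add: N_def numeral_fps_const, simp add: mult_ac)
  have p31: "(\<Sum>k=0..n. of_nat (n choose k) * 3 ^ (n - k) * tetra 15 27 48 107 (n - k) * tetranacci k)
      = 563 * N (power_sum 3 * power_sum 1)" (is "?lhs = _")
  proof -
    have "?lhs = N (563 * power_sum 3 * power_sum 1)"
      unfolding egf_power_sum3[symmetric] egf_tetranacci[symmetric] N_def egf_mult_nth by (simp only: mult.assoc)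
    then show ?thesis
      by (simp only: N_linear mult.assoc)
  qed
  have p22: "(\<Sum>k=0..n. of_nat (n choose k) * 2 ^ n * tetra 40 64 215 344 (n - k) * tetra 40 64 215 344 k)
      = 563 ^ 2 * N (power_sum 2 * power_sum 2)"
  proof -
    have "(\<Sum>k=0..n. of_nat (n choose k) * 2 ^ n * tetra 40 64 215 344 (n - k) * tetra 40 64 215 344 k)
      = N ((563 * power_sum 2) * (563 * power_sum 2))"
      unfolding egf_power_sum2[symmetric] N_def egf_mult_nth
      by (rule sum.cong) (auto simp flip: power_add)
    also have "\<dots> = N (563 * (563 * (power_sum 2 * power_sum 2)))"
      by (simp only: mult_ac)
    also have "\<dots> = 563 ^ 2 * N (power_sum 2 * power_sum 2)"
      by (simp only: N_linear power2_eq_square mult.assoc)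
    finally show ?thesis .
  qed
  have p2e2: "(\<Sum>k=0..n. of_nat (n choose k) * 2 ^ (n - k) * tetra 40 64 215 344 (n - k) * tetra_t k)
      = 563 * N (power_sum 2 * e2)" (is "?lhs = _")
  proof -
    have "?lhs = N (563 * power_sum 2 * e2)"
      unfolding egf_power_sum2[symmetric] egf_tetra_t[symmetric] N_def egf_mult_nth by (simp only: mult.assoc)
    then show ?thesis
      by (simp only: N_linear mult.assoc)
  qed
  have e22: "(\<Sum>k=0..n. of_nat (n choose k) * tetra_t (n - k) * tetra_t k) = N (e2 * e2)"
    unfolding egf_tetra_t[symmetric] N_def egf_mult_nth ..
  have p211: "(\<Sum>(k1, k2, k3) \<in> {(k1, k2, k3). k1 + k2 + k3 = n}.
         multinomial n [k1, k2, k3] * 2 ^ k1 * tetra 40 64 215 344 k1 * tetranacci k2 * tetranacci k3)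
      = 563 * N (power_sum 2 * power_sum 1 * power_sum 1)" (is "?lhs = _")
  proof -
    have "?lhs = N (563 * power_sum 2 * power_sum 1 * power_sum 1)"
      unfolding egf_power_sum2[symmetric] egf_tetranacci[symmetric] N_def egf_mult3_nth by (simp only: mult.assoc)
    then show ?thesis
      by (simp only: N_linear mult.assoc)
  qed
  have e2p11: "(\<Sum>(k1, k2, k3) \<in> {(k1, k2, k3). k1 + k2 + k3 = n}.
         multinomial n [k1, k2, k3] * tetra_t k1 * tetranacci k2 * tetranacci k3)
      = N (e2 * power_sum 1 * power_sum 1)"
    unfolding egf_tetra_t[symmetric] egf_tetranacci[symmetric] N_def egf_mult3_nth ..
  have e3p1: "(\<Sum>(k1, k2, k3) \<in> {(k1, k2, k3). k1 + k2 + k3 = n}.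
         multinomial n [k1, k2, k3] * (- 1) ^ k1 * tetra (- 5) 2 13 32 k1 * tetranacci k2)
      = - 563 * N (e3 * power_sum 1)"
  proof -
    have "(\<Sum>(k1, k2, k3) \<in> {(k1, k2, k3). k1 + k2 + k3 = n}.
         multinomial n [k1, k2, k3] * (- 1) ^ k1 * tetra (- 5) 2 13 32 k1 * tetranacci k2)
      = N (egf (\<lambda>n. (- 1) ^ n * tetra (- 5) 2 13 32 n) * egf tetranacci * egf (\<lambda>_. 1))"
      unfolding N_def egf_mult3_nth by (simp only: mult.assoc mult_1_right)
    also have "\<dots> = N (egf (\<lambda>n. (- 1) ^ n * tetra (- 5) 2 13 32 n) * egf (\<lambda>_. 1) * egf tetranacci)"
      by (simp only: mult_ac)
    also have "\<dots> = N (0 - 563 * (e3 * power_sum 1))"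
      unfolding egf_e3 egf_tetranacci by (simp only: mult.assoc mult_minus_left diff_0)
    also have "\<dots> = - 563 * N (e3 * power_sum 1)"
      by (simp add: N_def numeral_fps_const)
    finally show ?thesis .
  qed
  have B': "B / 563 = - B * N e4"
  proof -
    have "B / 563 = B / 563 * (- 563 * N e4)"
      by (simp only: e4[symmetric] mult_1_right)
    then show ?thesis by simp
  qed
  have A': "A / 563 ^ 2 * 4 ^ n * tetra 3052 4658 8804 16451 n = A * N (power_sum 4)"
    unfolding mult.assoc p4 by simp
  have e22': "N (e2 * e2) = (N (power_sum 2 * power_sum 2) - N (power_sum 4)
      + 4 * N (t1_series \<alpha> \<beta> \<gamma> \<delta>) + 12 * N e4) / 2"
    using N_symm(3) by (simp add: N_linear(1) mult.commute[of _ 2])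
  \<comment> \<open>Every sum is now a linear combination of the five quantities \<open>N\<close> of \<open>p\<^sub>4\<close>, \<open>p\<^sub>3 p\<^sub>1\<close>, \<open>p\<^sub>2 p\<^sub>2\<close>,
    the \<open>t1\<close> series and \<open>e\<^sub>4\<close>; the formulas for \<open>A\<close>, \<open>C\<close>, \<open>F\<close>, \<open>B\<close> and \<open>I\<close> are what makes the
    coefficients agree.\<close>
  show ?thesis
    unfolding t1 p1111 A' B' p31 p22 p2e2 e22 p211 e2p11 e3p1
    unfolding N_symm(1,2,4-6) e22' N_linear(1) A B C F I
    by (simp add: algebra_simps add_divide_distrib diff_divide_distrib)
qed

end
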